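(* Let $\vec H$ be a DAG with $\ell$ edges. Then $\mathrm{dtd}(\vec H)\le\lfloor \ell/5\rfloor+3$.
   Context: For a DAG $\vec H$, a source is a vertex of in-degree $0$. A DAG elimination forest of a DAG $\vec H$ is defined recursively: if $\vec H$ is empty, it is the empty forest; if the underlying undirected graph of $\vec H$ is disconnected, it is the union of DAG elimination forests (trees) of its connected components; if the underlying graph is connected and $\vec H$ has exactly one source $s$, it is the single-node tree $s$; otherwise (connected, at least two sources) it is a tree whose root is an arbitrarily chosen source $s$ of $\vec H$ and whose subtrees are the trees of a DAG elimination forest of the DAG obtained from $\vec H$ by deleting $s$ and all vertices reachable from $s$. The depth of a rooted forest is the maximum number of nodes on a root-to-leaf path. $\mathrm{dtd}(\vec H)$ is the minimum depth of a DAG elimination forest of $\vec H$. *)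

theory Defs
  imports Main
begin

text \<open>A DAG is given by a finite vertex set V and an arc set E \<subseteq> V \<times> V with
  acyclic E. All sub-DAGs arising in the elimination process are induced
  subgraphs, described by a vertex subset S (with arcs E restricted to S).\<close>

definition is_dag :: "'a set \<Rightarrow> ('a \<times> 'a) set \<Rightarrow> bool" where
  "is_dag V E \<longleftrightarrow> finite V \<and> E \<subseteq> V \<times> V \<and> acyclic E"

text \<open>Adjacency of the underlying undirected graph of the subgraph induced by S.\<close>
definition und_adj :: "('a \<times> 'a) set \<Rightarrow> 'a set \<Rightarrow> ('a \<times> 'a) set" where
  "und_adj E S = {(u, v). u \<in> S \<and> v \<in> S \<and> ((u, v) \<in> E \<or> (v, u) \<in> E)}"

definition component :: "('a \<times> 'a) set \<Rightarrow> 'a set \<Rightarrow> 'a \<Rightarrow> 'a set" where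
  "component E S v = {u \<in> S. (v, u) \<in> (und_adj E S)\<^sup>*}"

definition components :: "('a \<times> 'a) set \<Rightarrow> 'a set \<Rightarrow> 'a set set" where
  "components E S = component E S ` S"

definition und_connected :: "('a \<times> 'a) set \<Rightarrow> 'a set \<Rightarrow> bool" where
  "und_connected E S \<longleftrightarrow> S \<noteq> {} \<and> (\<forall>u\<in>S. \<forall>v\<in>S. (u, v) \<in> (und_adj E S)\<^sup>*)"

text \<open>Sources of the subgraph induced by S: vertices of in-degree 0.\<close>
definition sources :: "('a \<times> 'a) set \<Rightarrow> 'a set \<Rightarrow> 'a set" where
  "sources E S = {v \<in> S. \<not> (\<exists>u\<in>S. (u, v) \<in> E)}"

text \<open>Vertices reachable from s (including s) in the subgraph induced by S.\<close>
definition reach :: "('a \<times> 'a) set \<Rightarrow> 'a set \<Rightarrow> 'a \<Rightarrow> 'a set" where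
  "reach E S s = {v \<in> S. (s, v) \<in> (E \<inter> (S \<times> S))\<^sup>*}"

text \<open>elim_depth E S d: the DAG induced by S has a DAG elimination forest
  of depth d (depth = maximal number of nodes on a root-to-leaf path), following
  the recursive definition clause by clause.\<close>
inductive elim_depth :: "('a \<times> 'a) set \<Rightarrow> 'a set \<Rightarrow> nat \<Rightarrow> bool" for E where
  empty: "elim_depth E {} 0"
| disconnected: "\<lbrakk> S \<noteq> {}; \<not> und_connected E S;
                   \<forall>C\<in>components E S. elim_depth E C (d C) \<rbrakk>
                 \<Longrightarrow> elim_depth E S (Max (d ` components E S))"
| one_source: "\<lbrakk> und_connected E S; sources E S = {s} \<rbrakk> \<Longrightarrow> elim_depth E S 1"
| many_sources: "\<lbrakk> und_connected E S; card (sources E S) \<ge> 2; s \<in> sources E S;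
                   elim_depth E (S - reach E S s) d \<rbrakk>
                 \<Longrightarrow> elim_depth E S (Suc d)"

definition dtd :: "'a set \<Rightarrow> ('a \<times> 'a) set \<Rightarrow> nat" where
  "dtd V E = (LEAST d. elim_depth E V d)"

end

(* Write R(s) for the set reachable from a source s.  If some R(s) is entered by at least 5 arcs,
   deleting R(s) pays for one level.  If every R(s) is entered by at most 4 arcs, delete an arbitrary
   source; every component that remains has a source t with R(t) entered by at most 3 arcs.  Such a
   component behaves like a path that ends in t: for a source u with R(u) meeting R(t), at most one
   arc enters the union of R(t) and R(u) from the rest.  Deleting a source w above the tail of this
   arc cuts off t and u, and leaves on the other side components of the same kind with at least
   5 arcs fewer.  This fails to gain only if t, u, w are all the sources; but three sources that
   need depth 3 pairwise share descendants, which forces 6 arcs. *)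
theory Submission
  imports Defs
begin

section \<open>Reachable sets, sources and components\<close>

lemma reach_subset: "reach E S s \<subseteq> S"
  by (auto simp: reach_def)

lemma reach_self: "s \<in> S \<Longrightarrow> s \<in> reach E S s"
  by (simp add: reach_def)

lemma reach_step: "\<lbrakk>v \<in> reach E S s; (v, w) \<in> E; w \<in> S\<rbrakk> \<Longrightarrow> w \<in> reach E S s"
  by (auto simp: reach_def intro: rtrancl_into_rtrancl)

lemma reach_pred:
  assumes "v \<in> reach E S s" "v \<noteq> s"
  shows "\<exists>u\<in>reach E S s. (u, v) \<in> E"
proof -
  have "(s, v) \<in> (E \<inter> (S \<times> S))\<^sup>*" using assms by (simp add: reach_def)
  then show ?thesis using assms(2) by (cases rule: rtrancl.cases) (auto simp: reach_def)
qed

lemma reach_trans: "\<lbrakk>v \<in> reach E S s; w \<in> reach E S v\<rbrakk> \<Longrightarrow> w \<in> reach E S s"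
  by (auto simp: reach_def intro: rtrancl_trans)

lemma reach_mono: "C \<subseteq> S \<Longrightarrow> reach E C v \<subseteq> reach E S v"
  unfolding reach_def by (auto intro: rtrancl_mono[THEN subsetD, rotated])

lemma source_in_reach:
  assumes "v \<in> sources E S" "v \<in> reach E S s"
  shows "v = s"
  using assms reach_pred[OF assms(2)] reach_subset[of E S s] by (auto simp: sources_def)

text \<open>Walking backwards along arcs stops, because a finite acyclic relation is well-founded,
  and it can stop only at a source.\<close>

lemma ex_source_above:
  assumes "finite S" "acyclic E" "x \<in> S"
  shows "\<exists>s\<in>sources E S. x \<in> reach E S s"
proof -
  have "finite (E \<inter> (S \<times> S))" using assms(1) by simp
  moreover have "acyclic (E \<inter> (S \<times> S))" using assms(2) by (rule acyclic_subset) auto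
  ultimately have "wf (E \<inter> (S \<times> S))" by (rule finite_acyclic_wf)
  then show ?thesis using assms(3)
  proof (induction x rule: wf_induct_rule)
    case (less x)
    show ?case
    proof (cases "x \<in> sources E S")
      case True
      then show ?thesis using less.prems by (auto intro: reach_self)
    next
      case False
      then obtain u where "u \<in> S" "(u, x) \<in> E" using less.prems by (auto simp: sources_def)
      then show ?thesis using less by (blast intro: reach_step)
    qed
  qed
qed

text \<open>Deletion creates no new sources: an in-neighbour inside the deleted set would have put
  the vertex itself into that set.\<close>

lemma sources_Diff_reach: "sources E (S - reach E S s) \<subseteq> sources E S"
  by (auto simp: sources_def intro: reach_step)

section \<open>Connected components of the underlying undirected graph\<close>

lemma sym_und_adj: "sym (und_adj E S)"
  by (auto simp: sym_def und_adj_def)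

lemma component_closed:
  assumes "C \<in> components E S" "u \<in> C" "w \<in> S" "(u, w) \<in> E \<or> (w, u) \<in> E"
  shows "w \<in> C"
  using assms unfolding components_def component_def und_adj_def
  by (auto intro: rtrancl_into_rtrancl)

lemma component_connected:
  assumes "C \<in> components E S"
  shows "und_connected E C"
proof -
  obtain v where v: "v \<in> S" and C: "C = component E S v" using assms by (auto simp: components_def)
  \<comment> \<open>Connectedness of \<open>C\<close> asks for paths inside \<open>C\<close>; a path
    from \<open>v\<close> in \<open>S\<close> never leaves the component, so it serves.\<close>
  have from_v: "(v, u) \<in> (und_adj E C)\<^sup>*" if "(v, u) \<in> (und_adj E S)\<^sup>*" for u
    using that
  proof (induction rule: rtrancl_induct)
    case (step y z)
    have "y \<in> C" "z \<in> C" using step.hyps v unfolding C component_def und_adj_def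
      by (auto intro: rtrancl_into_rtrancl[unfolded und_adj_def])
    then have "(y, z) \<in> und_adj E C" using step.hyps by (auto simp: und_adj_def)
    then show ?case using step.IH by (rule rtrancl_into_rtrancl[rotated])
  qed simp
  have "v \<in> C" using v by (simp add: C component_def)
  moreover have "(a, b) \<in> (und_adj E C)\<^sup>*" if "a \<in> C" "b \<in> C" for a b
  proof -
    have "(v, a) \<in> (und_adj E C)\<^sup>*" "(v, b) \<in> (und_adj E C)\<^sup>*"
      using that from_v by (auto simp: C component_def)
    then show ?thesis using sym_rtrancl[OF sym_und_adj] by (meson rtrancl_trans symD)
  qed
  ultimately show ?thesis by (auto simp: und_connected_def)
qed

text \<open>The undirected path from \<open>a\<close> to \<open>b\<close> starts in \<open>A\<close>
  and ends outside, so one of its steps leaves \<open>A\<close>.\<close>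

lemma crossing_edge:
  assumes "und_connected E S" "a \<in> S" "a \<in> A" "b \<in> S" "b \<notin> A"
  shows "\<exists>x y. x \<in> S \<and> y \<in> S \<and> x \<notin> A \<and> y \<in> A \<and> ((x, y) \<in> E \<or> (y, x) \<in> E)"
proof -
  have "(a, b) \<in> (und_adj E S)\<^sup>*" using assms by (auto simp: und_connected_def)
  then show ?thesis using assms(5)
  proof (induction rule: rtrancl_induct)
    case base
    then show ?case using assms(3) by simp
  next
    case (step y z)
    then show ?case by (cases "y \<in> A") (auto simp: und_adj_def)
  qed
qed

text \<open>When \<open>A\<close> is closed under successors, a crossing arc can only point into
  \<open>A\<close>. This is the source of all new arcs in the later counts.\<close>

lemma entering_edge:
  assumes "und_connected E S" "a \<in> S" "a \<in> A" "b \<in> S" "b \<notin> A"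
    and closed: "\<And>x y. \<lbrakk>x \<in> A; (x, y) \<in> E; y \<in> S\<rbrakk> \<Longrightarrow> y \<in> A"
  shows "\<exists>x y. x \<in> S \<and> y \<in> S \<and> x \<notin> A \<and> y \<in> A \<and> (x, y) \<in> E"
  using crossing_edge[OF assms(1-5)] closed by blast

lemma components_subset: "C \<in> components E S \<Longrightarrow> C \<subseteq> S"
  by (auto simp: components_def component_def)

lemma component_sources:
  assumes "C \<in> components E S"
  shows "sources E C \<subseteq> sources E S"
  using components_subset[OF assms] component_closed[OF assms] unfolding sources_def by blast

text \<open>Connectedness of \<open>S\<close> gives an arc joining \<open>C\<close> to the rest. Its
  other end was deleted, since \<open>C\<close> is a whole component of what remains, and it points
  away from \<open>C\<close>, as otherwise its end in \<open>C\<close> would be reachable from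
  \<open>s\<close>.\<close>

lemma component_meets_reach:
  assumes "und_connected E S" "C \<in> components E (S - reach E S s)" "s \<in> S"
  shows "\<exists>x\<in>C. \<exists>y\<in>reach E S s. (x, y) \<in> E"
proof -
  have "C \<subseteq> S - reach E S s" by (rule components_subset[OF assms(2)])
  moreover obtain c where c: "c \<in> C" using component_connected[OF assms(2)]
    by (auto simp: und_connected_def)
  ultimately obtain x y where xy: "x \<in> S" "y \<in> S" "x \<notin> C" "y \<in> C" "(x, y) \<in> E \<or> (y, x) \<in> E"
    using crossing_edge[OF assms(1), of c C s] assms(3) reach_self[of s S E] by blast
  then have x: "x \<in> reach E S s" using component_closed[OF assms(2), of y x] by blast
  have "y \<notin> reach E S s" using xy \<open>C \<subseteq> _\<close> by blast
  then have "(y, x) \<in> E" using reach_step[OF x, of y] xy by blast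
  then show ?thesis using x xy by blast
qed

text \<open>A path from \<open>p\<close> to \<open>z\<close> must enter \<open>reach E S q\<close>
  by some arc \<open>(a, y)\<close>. As \<open>y\<close> also has a predecessor \<open>b\<close>
  inside that set, it receives two distinct arcs.\<close>

lemma common_descendant_two_preds:
  assumes "p \<in> sources E S" "q \<in> sources E S" "p \<noteq> q"
    and z: "z \<in> reach E S p" "z \<in> reach E S q"
  obtains y a b where "y \<in> reach E S p" "y \<in> reach E S q" "z \<in> reach E S y"
    "a \<in> reach E S p" "b \<in> reach E S q" "a \<noteq> b" "(a, y) \<in> E" "(b, y) \<in> E"
proof -
  let ?E = "E \<inter> (S \<times> S)"
  have pS: "p \<in> S" and qS: "q \<in> S" using assms by (auto simp: sources_def)
  have p: "p \<notin> reach E S q" using source_in_reach[OF assms(1)] assms(3) by blast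
  have "(p, z) \<in> ?E\<^sup>*" using z by (simp add: reach_def)
  then have "z \<in> reach E S q \<longrightarrow>
      (\<exists>a y. (p, a) \<in> ?E\<^sup>* \<and> (a, y) \<in> ?E \<and> (y, z) \<in> ?E\<^sup>* \<and> a \<notin> reach E S q \<and> y \<in> reach E S q)"
  proof (induction rule: rtrancl_induct)
    case base
    then show ?case using p by simp
  next
    case (step y z)
    show ?case
    proof (cases "y \<in> reach E S q")
      case True
      then show ?thesis using step by (meson rtrancl.rtrancl_into_rtrancl)
    next
      case False
      then show ?thesis using step.hyps by blast
    qed
  qed
  then obtain a y where ay: "(p, a) \<in> ?E\<^sup>*" "(a, y) \<in> ?E" "(y, z) \<in> ?E\<^sup>*"
    "a \<notin> reach E S q" "y \<in> reach E S q" using z by blast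
  \<comment> \<open>The vertex \<open>y\<close> has an in-arc and \<open>q\<close> has none, so the
    path from \<open>q\<close> to \<open>y\<close> has a last arc, whose tail is
    \<open>b\<close>.\<close>
  have "y \<noteq> q" using ay assms(2) by (auto simp: sources_def)
  then obtain b where b: "b \<in> reach E S q" "(b, y) \<in> E" using reach_pred ay(5) by metis
  have "a \<in> S" "y \<in> S" "(a, y) \<in> E" using ay(2) by simp_all
  have a: "a \<in> reach E S p" using ay(1) \<open>a \<in> S\<close> by (simp add: reach_def)
  show ?thesis
  proof (rule that)
    show "y \<in> reach E S p" using reach_step[OF a] \<open>(a, y) \<in> E\<close> \<open>y \<in> S\<close> .
    show "z \<in> reach E S y" using ay(3) z(1) by (simp add: reach_def)
    show "a \<noteq> b" using ay(4) b(1) by metis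
  qed (fact a ay(5) b \<open>(a, y) \<in> E\<close>)+
qed

section \<open>Elimination depth at most d\<close>

text \<open>\<open>elim_depth\<close> records the exact depth of a forest; an upper bound is
  monotone in \<open>d\<close> and can be shared by all components.\<close>

definition elim_le :: "('a \<times> 'a) set \<Rightarrow> 'a set \<Rightarrow> nat \<Rightarrow> bool" where
  "elim_le E S d \<longleftrightarrow> (\<exists>d'\<le>d. elim_depth E S d')"

lemma elim_le_mono: "\<lbrakk>elim_le E S d; d \<le> d'\<rbrakk> \<Longrightarrow> elim_le E S d'"
  unfolding elim_le_def using order_trans by blast

text \<open>Reduces every depth bound to connected sets; the empty and the connected case are
  included, so no case split is needed later.\<close>

lemma elim_le_components:
  assumes "finite S" "\<And>C. C \<in> components E S \<Longrightarrow> elim_le E C d"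
  shows "elim_le E S d"
proof -
  consider "S = {}" | "und_connected E S" | "S \<noteq> {}" "\<not> und_connected E S" by blast
  then show ?thesis
  proof cases
    case 1
    then show ?thesis using elim_depth.empty by (auto simp: elim_le_def)
  next
    case 2
    then obtain v where v: "v \<in> S" by (auto simp: und_connected_def)
    have "component E S v = S" using 2 v by (auto simp: component_def und_connected_def)
    then show ?thesis using assms(2) v by (metis components_def imageI)
  next
    case 3
    have "\<exists>f. \<forall>C\<in>components E S. f C \<le> d \<and> elim_depth E C (f C)"
      using assms(2) unfolding elim_le_def by metis
    then obtain f where f: "\<forall>C\<in>components E S. f C \<le> d \<and> elim_depth E C (f C)" by blast
    have "elim_depth E S (Max (f ` components E S))"
      using f by (intro elim_depth.disconnected[OF 3]) auto
    moreover have "Max (f ` components E S) \<le> d"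
      using f 3(1) assms(1) by (subst Max_le_iff) (auto simp: components_def)
    ultimately show ?thesis by (auto simp: elim_le_def)
  qed
qed

text \<open>Covers both rules for connected sets: with a single source the depth is 1, which is at
  most \<open>Suc d\<close> for every \<open>d\<close>.\<close>

lemma elim_le_delete_source:
  assumes "finite S" "und_connected E S" "s \<in> sources E S" "elim_le E (S - reach E S s) d"
  shows "elim_le E S (Suc d)"
proof (cases "card (sources E S) \<ge> 2")
  case True
  obtain d' where "d' \<le> d" "elim_depth E (S - reach E S s) d'"
    using assms(4) by (auto simp: elim_le_def)
  then have "elim_depth E S (Suc d')"
    using elim_depth.many_sources[OF assms(2) True assms(3)] by blast
  then show ?thesis using \<open>d' \<le> d\<close> unfolding elim_le_def by (intro exI[of _ "Suc d'"]) simp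
next
  case False
  have "finite (sources E S)" using assms(1) by (simp add: sources_def)
  then have "card (sources E S) \<noteq> 0" using assms(3) by auto
  then have "card (sources E S) = 1" using False by linarith
  then have "sources E S = {s}" using assms(3) by (auto simp: card_1_singleton_iff)
  then have "elim_depth E S 1" by (rule elim_depth.one_source[OF assms(2)])
  then show ?thesis by (auto simp: elim_le_def)
qed

lemma elim_le_delete_source_components:
  assumes "finite S" "und_connected E S" "s \<in> sources E S"
    and "\<And>C. C \<in> components E (S - reach E S s) \<Longrightarrow> elim_le E C d"
  shows "elim_le E S (Suc d)"
proof (rule elim_le_delete_source[OF assms(1-3)])
  show "elim_le E (S - reach E S s) d" by (rule elim_le_components) (simp_all add: assms(1,4))
qed

lemma components_psubset:
  assumes "und_connected E S" "s \<in> sources E S" "C \<in> components E (S - reach E S s)"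
  shows "C \<subset> S"
proof -
  have "s \<in> S" using assms(2) by (simp add: sources_def)
  then show ?thesis using components_subset[OF assms(3)] reach_self[of s S E] by blast
qed

text \<open>Each deletion removes the chosen source and creates no new one, so every level uses up a
  source.\<close>

lemma elim_le_card_sources:
  assumes "finite S" "acyclic E"
  shows "elim_le E S (card (sources E S))"
  using assms(1)
proof (induction "card S" arbitrary: S rule: less_induct)
  case less
  \<comment> \<open>Stated for all connected subsets because a component may be \<open>S\<close>
    itself; the induction hypothesis is used only after a source has been deleted.\<close>
  have conn: "elim_le E C (card (sources E C))"
    if C: "C \<subseteq> S" "und_connected E C" for C
  proof -
    have fin: "finite C" using C less.prems finite_subset by blast
    obtain s where s: "s \<in> sources E C"
      using ex_source_above[OF fin assms(2)] C(2) unfolding und_connected_def by blast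
    have sC: "s \<in> C" using s by (simp add: sources_def)
    let ?D = "C - reach E C s"
    have sub: "?D \<subset> C" using sC reach_self[OF sC, of E] by blast
    have "card ?D < card S"
      using psubset_card_mono[OF fin sub] card_mono[OF less.prems C(1)] by simp
    then have *: "elim_le E ?D (card (sources E ?D))" using less.hyps fin by blast
    have "sources E ?D \<subset> sources E C"
      using sources_Diff_reach[of E C s] s reach_self[OF sC, of E] by (auto simp: sources_def)
    moreover have "finite (sources E C)" using fin by (simp add: sources_def)
    ultimately have "card (sources E ?D) < card (sources E C)" by (simp add: psubset_card_mono)
    then show ?thesis using elim_le_mono[OF elim_le_delete_source[OF fin C(2) s *]] by simp
  qed
  show ?case
  proof (rule elim_le_components[OF less.prems])
    fix C assume C: "C \<in> components E S"
    have "C \<subseteq> S" by (rule components_subset[OF C])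
    moreover have "card (sources E C) \<le> card (sources E S)"
      using component_sources[OF C] less.prems by (intro card_mono) (auto simp: sources_def)
    ultimately show "elim_le E C (card (sources E S))"
      using conn component_connected[OF C] elim_le_mono by blast
  qed
qed

lemma elim_le_if_sources_subset:
  assumes "finite S" "acyclic E" "sources E S \<subseteq> set xs"
  shows "elim_le E S (length xs)"
  using elim_le_card_sources[OF assms(1,2)] card_mono[OF _ assms(3)] card_length[of xs]
  by (meson List.finite_set elim_le_mono order_trans)

section \<open>Arcs entering a set\<close>

text \<open>Tails may lie inside \<open>X\<close> as well. For a successor-closed \<open>X\<close>
  these are exactly the arcs of \<open>S\<close> that disappear when \<open>X\<close> is
  deleted.\<close>

definition in_arcs :: "('a \<times> 'a) set \<Rightarrow> 'a set \<Rightarrow> 'a set \<Rightarrow> ('a \<times> 'a) set" where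
  "in_arcs E S X = {(a, b) \<in> E. a \<in> S \<and> b \<in> S \<and> b \<in> X}"

abbreviation arcs :: "('a \<times> 'a) set \<Rightarrow> 'a set \<Rightarrow> ('a \<times> 'a) set" where
  "arcs E S \<equiv> E \<inter> (S \<times> S)"

lemma finite_in_arcs: "finite S \<Longrightarrow> finite (in_arcs E S X)"
  by (rule finite_subset[of _ "S \<times> S"]) (auto simp: in_arcs_def)

text \<open>All lower bounds on numbers of arcs are obtained from this by exhibiting an explicit
  list.\<close>

lemma card_in_arcs_ge:
  assumes "finite S" "distinct es" "set es \<subseteq> in_arcs E S X"
  shows "length es \<le> card (in_arcs E S X)"
  using card_mono[OF finite_in_arcs[OF assms(1)] assms(3)] distinct_card[OF assms(2)] by simp

lemma card_arcs_Diff: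
  assumes "finite S" "C \<subseteq> S" "C \<inter> X = {}"
  shows "card (arcs E C) + card (in_arcs E S X) \<le> card (arcs E S)"
proof -
  have "finite (arcs E S)" using assms(1) by simp
  moreover have "finite (arcs E C)" using assms finite_subset by fast
  moreover have "arcs E C \<inter> in_arcs E S X = {}" using assms by (auto simp: in_arcs_def)
  ultimately show ?thesis
    using finite_in_arcs[OF assms(1)] assms(2)
    by (subst card_Un_disjoint[symmetric]) (auto intro!: card_mono simp: in_arcs_def)
qed

lemma card_in_arcs_reach_mono:
  assumes "finite S" "C \<subseteq> S"
  shows "card (in_arcs E C (reach E C v)) \<le> card (in_arcs E S (reach E S v))"
  using reach_mono[OF assms(2), of E v] assms
  by (intro card_mono finite_in_arcs) (auto simp: in_arcs_def)

text \<open>Some arc leads from \<open>C\<close> into the deleted set. For a source \<open>t\<close>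
  of \<open>C\<close> above its tail, this arc counts for \<open>t\<close> in \<open>S\<close> but
  not in \<open>C\<close>, so the bound 4 drops to 3.\<close>

lemma component_light_source:
  assumes "finite S" "acyclic E" "und_connected E S" "s \<in> S"
    and "\<And>v. v \<in> S \<Longrightarrow> card (in_arcs E S (reach E S v)) \<le> 4"
    and C: "C \<in> components E (S - reach E S s)"
  shows "\<exists>t\<in>sources E C. card (in_arcs E C (reach E C t)) \<le> 3"
proof -
  have CS: "C \<subseteq> S - reach E S s" by (rule components_subset[OF C])
  have fin: "finite C" using CS assms(1) finite_subset by blast
  obtain x y where xy: "x \<in> C" "y \<in> reach E S s" "(x, y) \<in> E"
    using component_meets_reach[OF assms(3) C assms(4)] by blast
  obtain t where t: "t \<in> sources E C" "x \<in> reach E C t"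
    using ex_source_above[OF fin assms(2) xy(1)] by blast
  have mono: "reach E C t \<subseteq> reach E S t" using CS by (intro reach_mono) blast
  have "y \<in> S" using xy reach_subset[of E S s] by blast
  then have "y \<in> reach E S t" using mono t xy reach_step by (metis subsetD)
  then have "(x, y) \<in> in_arcs E S (reach E S t)" "(x, y) \<notin> in_arcs E C (reach E C t)"
    using xy CS \<open>y \<in> S\<close> by (auto simp: in_arcs_def)
  moreover have "in_arcs E C (reach E C t) \<subseteq> in_arcs E S (reach E S t)"
    using mono CS by (auto simp: in_arcs_def)
  ultimately have "card (in_arcs E C (reach E C t)) < card (in_arcs E S (reach E S t))"
    by (intro psubset_card_mono finite_in_arcs assms) auto
  moreover have "t \<in> S" using t CS by (auto simp: sources_def)
  ultimately show ?thesis using assms(5)[of t] t by (intro bexI[of _ t]) auto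
qed

section \<open>Connected DAGs with a light source\<close>

text \<open>Since depth 2 is not enough, deleting \<open>s\<close> leaves a component of depth above
  1. It contains both \<open>p\<close> and \<open>q\<close>, which therefore share a descendant out
  of reach of \<open>s\<close>.\<close>

lemma three_sources_two_preds:
  assumes "finite S" "acyclic E" "und_connected E S" "sources E S = {p, q, s}"
    and "p \<noteq> q" "p \<noteq> s" "q \<noteq> s" "\<not> elim_le E S 2"
  shows "\<exists>y a b. y \<in> reach E S p \<and> y \<in> reach E S q \<and> y \<notin> reach E S s \<and> a \<noteq> b
           \<and> (a, y) \<in> in_arcs E S S \<and> (b, y) \<in> in_arcs E S S"
proof -
  let ?D = "S - reach E S s"
  have s_src: "s \<in> sources E S" and pq_src: "p \<in> sources E S" "q \<in> sources E S"
    by (simp_all add: assms(4))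
  have "\<not> elim_le E S (Suc 1)" using assms(8) by (simp add: numeral_2_eq_2)
  then obtain C where C: "C \<in> components E ?D" "\<not> elim_le E C 1"
    using elim_le_delete_source_components[OF assms(1,3) s_src, of 1] by blast
  have CD: "C \<subseteq> ?D" by (rule components_subset[OF C(1)])
  have fin: "finite C" by (rule finite_subset[OF CD]) (simp add: assms(1))
  have sub: "sources E C \<subseteq> sources E S"
    by (rule order_trans[OF component_sources[OF C(1)] sources_Diff_reach])
  have "s \<in> S" using s_src by (simp add: sources_def)
  then have "s \<notin> C" using CD reach_self[of s S E] by blast
  then have "s \<notin> sources E C" by (simp add: sources_def)
  then have src: "sources E C \<subseteq> {p, q}" using sub unfolding assms(4) by blast
  have not_single: "\<not> sources E C \<subseteq> {r}" for r
  proof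
    assume "sources E C \<subseteq> {r}"
    then have "elim_le E C (length [r])" by (intro elim_le_if_sources_subset fin assms(2)) simp
    then show False using C(2) by simp
  qed
  have "p \<in> sources E C" using src not_single[of q] by blast
  moreover have "q \<in> sources E C" using src not_single[of p] by blast
  ultimately have pq: "p \<in> C" "q \<in> C" by (auto simp: sources_def)
  have cover: "C \<subseteq> reach E C p \<union> reach E C q"
  proof
    fix x assume "x \<in> C"
    then obtain r where "r \<in> sources E C" "x \<in> reach E C r"
      using ex_source_above[OF fin assms(2)] by blast
    then show "x \<in> reach E C p \<union> reach E C q" using src by blast
  qed
  \<comment> \<open>If the two reachable sets were disjoint, an arc entering that of
    \<open>p\<close> would start in that of \<open>q\<close>, and its head would lie in
    both.\<close>
  have "\<exists>z. z \<in> reach E C p \<and> z \<in> reach E C q"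
  proof (rule ccontr)
    assume none: "\<nexists>z. z \<in> reach E C p \<and> z \<in> reach E C q"
    have "q \<notin> reach E C p" using none reach_self[OF pq(2)] by blast
    then have "\<exists>x y. x \<in> C \<and> y \<in> C \<and> x \<notin> reach E C p \<and> y \<in> reach E C p \<and> (x, y) \<in> E"
      by (rule entering_edge[OF component_connected[OF C(1)] pq(1) reach_self[OF pq(1)] pq(2)])
        (rule reach_step)
    then obtain x y
      where xy: "x \<in> C" "y \<in> C" "x \<notin> reach E C p" "y \<in> reach E C p" "(x, y) \<in> E"
      by (elim exE conjE)
    then have "x \<in> reach E C q" using cover by blast
    then have "y \<in> reach E C q" using xy(5,2) by (rule reach_step)
    then show False using none xy(4) by blast
  qed
  then obtain z where z: "z \<in> reach E C p" "z \<in> reach E C q" by blast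
  have zS: "z \<in> reach E S p" "z \<in> reach E S q" "z \<notin> reach E S s"
    using z reach_mono[of C S E p] reach_mono[of C S E q] CD reach_subset[of E C p] by blast+
  obtain y a b where y: "y \<in> reach E S p" "y \<in> reach E S q" "z \<in> reach E S y"
    "a \<in> reach E S p" "b \<in> reach E S q" "a \<noteq> b" "(a, y) \<in> E" "(b, y) \<in> E"
    using common_descendant_two_preds[OF pq_src assms(5) zS(1,2)] by metis
  \<comment> \<open>From \<open>y\<close> one reaches \<open>z\<close>, which is out of reach of
    \<open>s\<close>.\<close>
  have "y \<notin> reach E S s" using reach_trans[OF _ y(3)] zS(3) by blast
  moreover have "a \<in> S" "b \<in> S" "y \<in> S" using y(1,4,5) subsetD[OF reach_subset] by metis+
  ultimately show ?thesis using y(1,2,6-8)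
    by (intro exI[of _ y] exI[of _ a] exI[of _ b]) (simp add: in_arcs_def)
qed

text \<open>If depth 2 fails, each pair of sources yields a vertex with two in-arcs. The three
  vertices differ, as each is out of reach of a different source, so there are six arcs and the
  bound is at least 3, the number of sources.\<close>

lemma three_sources:
  assumes "finite S" "acyclic E" "und_connected E S" "sources E S = {p, q, s}"
    and "p \<noteq> q" "p \<noteq> s" "q \<noteq> s"
  shows "elim_le E S (card (arcs E S) div 5 + 2)"
proof (cases "elim_le E S 2")
  case True
  then show ?thesis by (rule elim_le_mono) simp
next
  case False
  obtain y1 a1 b1 where 1: "y1 \<in> reach E S p" "y1 \<in> reach E S q" "y1 \<notin> reach E S s" "a1 \<noteq> b1"
    "(a1, y1) \<in> in_arcs E S S" "(b1, y1) \<in> in_arcs E S S"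
    using three_sources_two_preds[OF assms False] by blast
  obtain y2 a2 b2 where 2: "y2 \<in> reach E S p" "y2 \<in> reach E S s" "y2 \<notin> reach E S q" "a2 \<noteq> b2"
    "(a2, y2) \<in> in_arcs E S S" "(b2, y2) \<in> in_arcs E S S"
    using three_sources_two_preds[OF assms(1-3), of p s q] assms(4-7) False by blast
  obtain y3 a3 b3 where 3: "y3 \<in> reach E S q" "y3 \<in> reach E S s" "y3 \<notin> reach E S p" "a3 \<noteq> b3"
    "(a3, y3) \<in> in_arcs E S S" "(b3, y3) \<in> in_arcs E S S"
    using three_sources_two_preds[OF assms(1-3), of q s p] assms(4-7) False by blast
  have "length [(a1, y1), (b1, y1), (a2, y2), (b2, y2), (a3, y3), (b3, y3)]
      \<le> card (in_arcs E S S)"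
    using 1 2 3 by (intro card_in_arcs_ge[OF assms(1)]) auto
  moreover have "in_arcs E S S = arcs E S" by (auto simp: in_arcs_def)
  ultimately have "length [p, q, s] \<le> card (arcs E S) div 5 + 2" by simp
  moreover have "elim_le E S (length [p, q, s])"
    using assms(4) by (intro elim_le_if_sources_subset assms(1,2)) simp
  ultimately show ?thesis by (rule elim_le_mono[rotated])
qed

text \<open>The two arcs at \<open>y\<close> count for both \<open>t\<close> and \<open>u\<close>. A
  second arc entering \<open>A\<close> from outside would exceed the budget of 3 for
  \<open>t\<close> or of 4 for \<open>u\<close>.\<close>

lemma light_pair_entering_unique:
  assumes "finite S"
    and t: "t \<in> sources E S" "card (in_arcs E S (reach E S t)) \<le> 3"
    and u: "u \<in> sources E S" "card (in_arcs E S (reach E S u)) \<le> 4"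
    and y: "y \<in> reach E S t" "y \<in> reach E S u" "a \<noteq> b" "(a, y) \<in> E" "(b, y) \<in> E"
      "a \<in> A" "b \<in> A"
    and A: "A = reach E S t \<union> reach E S u"
    and x: "x1 \<in> S - A" "y1 \<in> A" "(x1, y1) \<in> E" "x2 \<in> S - A" "y2 \<in> A" "(x2, y2) \<in> E"
  shows "(x1, y1) = (x2, y2)"
proof (rule ccontr)
  assume neq: "(x1, y1) \<noteq> (x2, y2)"
  let ?T = "reach E S t" and ?U = "reach E S u"
  have AS: "A \<subseteq> S" using reach_subset A by fast
  have TA: "?T \<subseteq> A" and UA: "?U \<subseteq> A" by (simp_all add: A)
  have yS: "y \<in> S" "a \<in> S" "b \<in> S" using y AS TA by blast+
  \<comment> \<open>A head \<open>h\<close> with an in-arc is not the source \<open>r\<close>, so it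
    also has a predecessor inside the reachable set: an arc from outside brings a second arc with
    it.\<close>
  have pred: "\<exists>c\<in>R. (c, h) \<in> E"
    if "R = reach E S r" "h \<in> R" "(g, h) \<in> E" "g \<in> S" "r \<in> sources E S" for R g h r
    using that reach_pred[of h E S r] by (auto simp: sources_def)
  have T: "length es \<le> 3" if "distinct es" "set es \<subseteq> in_arcs E S ?T" for es
    using card_in_arcs_ge[OF assms(1) that] t(2) by linarith
  have U: "length es \<le> 4" if "distinct es" "set es \<subseteq> in_arcs E S ?U" for es
    using card_in_arcs_ge[OF assms(1) that] u(2) by linarith
  \<comment> \<open>Two arcs at \<open>y\<close> and two at \<open>h1\<close> are four arcs for
    \<open>t\<close>. Hence every arc entering \<open>A\<close> has its head in
    \<open>?U\<close>.\<close>
  have mixed: False if g: "g1 \<in> S - A" "h1 \<in> ?T" "h1 \<notin> ?U" "(g1, h1) \<in> E" for g1 h1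
  proof -
    obtain c where c: "c \<in> ?T" "(c, h1) \<in> E" using pred[OF refl g(2) g(4)] g t by blast
    have "c \<in> A" "h1 \<in> A" using c(1) g(2) TA by blast+
    then have "c \<in> S" "h1 \<in> S" "g1 \<noteq> c" "h1 \<noteq> y" using AS g y(2) by blast+
    then have dist: "distinct [(a, y), (b, y), (g1, h1), (c, h1)]" using y(3) by simp
    have "set [(a, y), (b, y), (g1, h1), (c, h1)] \<subseteq> in_arcs E S ?T"
      using y yS c g \<open>c \<in> S\<close> \<open>h1 \<in> S\<close> by (simp add: in_arcs_def)
    from T[OF dist this] show False by simp
  qed
  \<comment> \<open>Two arcs at \<open>y\<close>, two at \<open>h1\<close> and the second entering
    arc are five arcs for \<open>u\<close>. Hence both heads lie in \<open>?T\<close> too, which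
    gives four arcs for \<open>t\<close>.\<close>
  have both: False if g: "g1 \<in> S - A" "h1 \<in> ?U" "h1 \<notin> ?T" "(g1, h1) \<in> E"
    "g2 \<in> S - A" "h2 \<in> ?U" "(g2, h2) \<in> E" "(g1, h1) \<noteq> (g2, h2)" for g1 h1 g2 h2
  proof -
    obtain c where c: "c \<in> ?U" "(c, h1) \<in> E" using pred[OF refl g(2) g(4)] g u by blast
    have "c \<in> A" "h1 \<in> A" "h2 \<in> A" using c(1) g(2,6) UA by blast+
    then have S: "c \<in> S" "h1 \<in> S" "h2 \<in> S"
      and "g1 \<noteq> c" "g2 \<noteq> c" "g2 \<noteq> a" "g2 \<noteq> b" "h1 \<noteq> y"
      using AS g(1,3,5) y(1,6,7) by blast+
    then have dist: "distinct [(a, y), (b, y), (g1, h1), (c, h1), (g2, h2)]" using y(3) g(8) by auto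
    have "set [(a, y), (b, y), (g1, h1), (c, h1), (g2, h2)] \<subseteq> in_arcs E S ?U"
      using y yS c g S by (simp add: in_arcs_def)
    from U[OF dist this] show False by simp
  qed
  have "y1 \<in> ?U" "y2 \<in> ?U"
    using mixed[of x1 y1] mixed[of x2 y2] x unfolding A by blast+
  moreover have "\<not> (y1 \<in> ?T \<and> y2 \<in> ?T)"
  proof
    assume T12: "y1 \<in> ?T \<and> y2 \<in> ?T"
    have "y1 \<in> S" "y2 \<in> S" using x AS by blast+
    then have sub: "set [(a, y), (b, y), (x1, y1), (x2, y2)] \<subseteq> in_arcs E S ?T"
      using y yS x T12 by (simp add: in_arcs_def)
    have "a \<noteq> x1" "a \<noteq> x2" "b \<noteq> x1" "b \<noteq> x2" using x y(6,7) by blast+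
    then have "distinct [(a, y), (b, y), (x1, y1), (x2, y2)]" using y(3) neq by auto
    from T[OF this sub] show False by simp
  qed
  ultimately show False using both[of x1 y1 x2 y2] both[of x2 y2 x1 y1] x neq by metis
qed

text \<open>The components left after a deletion inherit the bound 4 and have a light source again,
  so induction on the size of \<open>S\<close> applies.\<close>

lemma elim_le_light:
  assumes "finite S" "acyclic E" "und_connected E S"
    and "\<And>v. v \<in> S \<Longrightarrow> card (in_arcs E S (reach E S v)) \<le> 4"
    and "\<exists>t\<in>sources E S. card (in_arcs E S (reach E S t)) \<le> 3"
  shows "elim_le E S (card (arcs E S) div 5 + 2)"
  using assms(1,3-5)
proof (induction "card S" arbitrary: S rule: less_induct)
  case less
  note fin = less.prems(1) and conn = less.prems(2) and le4 = less.prems(3)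
  obtain t where t: "t \<in> sources E S" "card (in_arcs E S (reach E S t)) \<le> 3"
    using less.prems(4) by blast
  have tS: "t \<in> S" using t by (simp add: sources_def)
  have few: "elim_le E S (card (arcs E S) div 5 + 2)"
    if "sources E S \<subseteq> set xs" "length xs \<le> 2" for xs
    using elim_le_mono[OF elim_le_if_sources_subset[OF fin assms(2) that(1)]] that(2) by simp
  show ?case
  proof (cases "sources E S \<subseteq> {t}")
    case True
    then show ?thesis using few[of "[t]"] by simp
  next
    case False
    then obtain v where "v \<in> sources E S" "v \<noteq> t" by blast
    then have v: "v \<in> S" "v \<notin> reach E S t"
      using source_in_reach[of v E S t] by (auto simp: sources_def)
    have "\<exists>x y. x \<in> S \<and> y \<in> S \<and> x \<notin> reach E S t \<and> y \<in> reach E S t \<and> (x, y) \<in> E"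
      by (rule entering_edge[OF conn tS reach_self[OF tS] v]) (rule reach_step)
    then obtain x0 z where xz: "x0 \<in> S" "x0 \<notin> reach E S t" "z \<in> reach E S t" "(x0, z) \<in> E" "z \<in> S"
      by (elim exE conjE)
    \<comment> \<open>The source \<open>u\<close> lies above the tail of an arc into
      \<open>reach E S t\<close>, so \<open>t\<close> and \<open>u\<close> share the descendant
      \<open>z\<close>.\<close>
    obtain u where u: "u \<in> sources E S" "x0 \<in> reach E S u"
      using ex_source_above[OF fin assms(2) xz(1)] by blast
    have uS: "u \<in> S" using u by (simp add: sources_def)
    have "t \<noteq> u" using u xz by blast
    have "z \<in> reach E S u" by (rule reach_step[OF u(2) xz(4,5)])
    define A where "A = reach E S t \<union> reach E S u"
    have AS: "A \<subseteq> S" using reach_subset A_def by fast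
    have A_closed: "h \<in> A" if "g \<in> A" "(g, h) \<in> E" "h \<in> S" for g h
      using that by (auto simp: A_def intro: reach_step)
    obtain y a b where y: "y \<in> reach E S t" "y \<in> reach E S u" "a \<noteq> b" "(a, y) \<in> E" "(b, y) \<in> E"
      "a \<in> A" "b \<in> A"
      using common_descendant_two_preds[OF t(1) u(1) \<open>t \<noteq> u\<close> xz(3) \<open>z \<in> reach E S u\<close>]
      by (metis A_def UnCI)
    have unique: "(x1, y1) = (x2, y2)"
      if "x1 \<in> S - A" "y1 \<in> A" "(x1, y1) \<in> E" "x2 \<in> S - A" "y2 \<in> A" "(x2, y2) \<in> E" for x1 y1 x2 y2
      using light_pair_entering_unique[OF fin t u(1) le4[OF uS] y A_def that] .
    have srcA: "v \<in> {t, u}" if "v \<in> sources E S" "v \<in> A" for v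
      using that source_in_reach[OF that(1), of t] source_in_reach[OF that(1), of u]
      by (auto simp: A_def)
    show ?thesis
    proof (cases "S \<subseteq> A")
      case True
      then have "sources E S \<subseteq> A" by (auto simp: sources_def)
      then have "sources E S \<subseteq> set [t, u]" using srcA by auto
      then show ?thesis by (rule few) simp
    next
      case False
      then obtain v where v: "v \<in> S" "v \<notin> A" by blast
      have tA: "t \<in> A" and uA: "u \<in> A" using reach_self[OF tS] reach_self[OF uS] by (simp_all add: A_def)
      have "\<exists>x y. x \<in> S \<and> y \<in> S \<and> x \<notin> A \<and> y \<in> A \<and> (x, y) \<in> E"
        by (rule entering_edge[OF conn tS tA v]) (rule A_closed)
      then obtain x y' where xy: "x \<in> S" "x \<notin> A" "y' \<in> A" "(x, y') \<in> E"
        by (elim exE conjE)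
      \<comment> \<open>By \<open>unique\<close>, \<open>(x, y')\<close> is the only arc into
        \<open>A\<close>; deleting a source above \<open>x\<close> separates \<open>A\<close> from
        the rest.\<close>
      obtain w where w: "w \<in> sources E S" "x \<in> reach E S w"
        using ex_source_above[OF fin assms(2) xy(1)] by blast
      have wS: "w \<in> S" using w by (simp add: sources_def)
      have wA: "w \<notin> A"
        using reach_trans[OF _ w(2), of t] reach_trans[OF _ w(2), of u] xy(2) by (auto simp: A_def)
      let ?W = "reach E S w"
      show ?thesis
      \<comment> \<open>If \<open>A\<close> and \<open>?W\<close> cover \<open>S\<close>, only three
        sources exist. Otherwise a further arc enters the union and completes a count of
        five.\<close>
      proof (cases "S \<subseteq> A \<union> ?W")
        case True
        have neq: "t \<noteq> w" "u \<noteq> w" using wA tA uA by blast+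
        have "v \<in> {t, u, w}" if v: "v \<in> sources E S" for v
        proof -
          have "v \<in> A \<or> v \<in> ?W" using v True by (auto simp: sources_def)
          then show ?thesis using srcA[OF v] source_in_reach[OF v, of w] by auto
        qed
        then have "sources E S = {t, u, w}" using t(1) u(1) w(1) by blast
        from three_sources[OF fin assms(2) conn this \<open>t \<noteq> u\<close> neq] show ?thesis .
      next
        case False
        then obtain v where v: "v \<in> S" "v \<notin> A \<union> ?W" by blast
        have "\<exists>x y. x \<in> S \<and> y \<in> S \<and> x \<notin> A \<union> ?W \<and> y \<in> A \<union> ?W \<and> (x, y) \<in> E"
        proof (rule entering_edge[OF conn tS UnI1[OF tA] v])
          fix g h assume "g \<in> A \<union> ?W" "(g, h) \<in> E" "h \<in> S"
          then show "h \<in> A \<union> ?W" using A_closed[of g h] reach_step[of g E S w h] by auto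
        qed
        then obtain x' y'' where x': "x' \<in> S" "x' \<notin> A \<union> ?W" "y'' \<in> A \<union> ?W" "(x', y'') \<in> E"
          by (elim exE conjE)
        \<comment> \<open>Otherwise \<open>unique\<close> would give \<open>x' = x\<close>, although
          \<open>x\<close> lies in \<open>?W\<close> and \<open>x'\<close> does not.\<close>
        have y''A: "y'' \<notin> A"
          using unique[of x' y'' x y'] x' xy w(2) by blast
        then have y''W: "y'' \<in> ?W" using x' by blast
        have "y'' \<noteq> w" using x' w(1) by (auto simp: sources_def)
        then obtain c where c: "c \<in> ?W" "(c, y'') \<in> E" using reach_pred y''W by metis
        \<comment> \<open>Two arcs at \<open>y\<close>, the arc into \<open>A\<close>, and two at
          \<open>y''\<close>, one from outside and one from within \<open>?W\<close>. The vertices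
          \<open>y\<close> and \<open>y'\<close> may coincide; the tails still differ.\<close>
        let ?es = "[(a, y), (b, y), (x, y'), (x', y''), (c, y'')]"
        have yA: "y \<in> A" using y by (simp add: A_def)
        have "a \<noteq> x" "b \<noteq> x" "y \<noteq> y''" "y' \<noteq> y''" "x' \<noteq> c"
          using y(6,7) xy(2,3) yA y''A x'(2) c(1) by blast+
        then have dist: "distinct ?es" using y(3) by auto
        have "a \<in> S" "b \<in> S" "c \<in> S" "y \<in> S" "y' \<in> S" "y'' \<in> S"
          using y(6,7) xy(3) yA c(1) y''W AS reach_subset[of E S w] by blast+
        then have "set ?es \<subseteq> in_arcs E S (A \<union> ?W)"
          using y(4,5) yA x'(1,4) xy(1,3,4) c(2) y''W by (simp add: in_arcs_def)
        from card_in_arcs_ge[OF fin dist this]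
        have five: "5 \<le> card (in_arcs E S (A \<union> ?W))" by simp
        then have five_S: "5 \<le> card (arcs E S)"
          using card_arcs_Diff[OF fin, of "{}" "A \<union> ?W" E] by (simp del: Un_iff)
        have "elim_le E C (card (arcs E S) div 5 + 1)" if C: "C \<in> components E (S - ?W)" for C
        proof -
          have CS: "C \<subseteq> S - ?W" by (rule components_subset[OF C])
          have finC: "finite C" using CS fin finite_subset by blast
          note connC = component_connected[OF C]
          \<comment> \<open>A component meeting both sides would contain an arc into
            \<open>A\<close>, hence \<open>x\<close>, which was deleted.\<close>
          have "C \<subseteq> A \<or> C \<inter> A = {}"
          proof (rule ccontr)
            assume "\<not> ?thesis"
            then obtain p q where "p \<in> C" "p \<in> A" "q \<in> C" "q \<notin> A" by blast
            then have "\<exists>g h. g \<in> C \<and> h \<in> C \<and> g \<notin> A \<and> h \<in> A \<and> (g, h) \<in> E"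
              using A_closed CS by (intro entering_edge[OF connC, of p A q]) blast+
            then obtain g h where gh: "g \<in> C" "h \<in> C" "g \<notin> A" "h \<in> A" "(g, h) \<in> E"
              by (elim exE conjE)
            then have "g = x" using unique[of g h x y'] xy CS by blast
            then show False using gh w(2) CS by blast
          qed
          then show ?thesis
          proof
            \<comment> \<open>Here at most the two sources \<open>t\<close> and \<open>u\<close>
              remain, and depth 2 is affordable because \<open>S\<close> has at least five
              arcs.\<close>
            assume CA: "C \<subseteq> A"
            have "sources E C \<subseteq> sources E S"
              by (rule order_trans[OF component_sources[OF C] sources_Diff_reach])
            moreover have "sources E C \<subseteq> A" using CA by (auto simp: sources_def)
            ultimately have "sources E C \<subseteq> set [t, u]" using srcA by auto
            from elim_le_if_sources_subset[OF finC assms(2) this]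
            show ?thesis by (rule elim_le_mono) (use five_S in simp)
          next
            \<comment> \<open>Here all five counted arcs are lost, so the quotient drops by one and
              pays for the level of \<open>w\<close>.\<close>
            assume "C \<inter> A = {}"
            then have "C \<subseteq> S" "C \<inter> (A \<union> ?W) = {}" using CS by blast+
            from card_arcs_Diff[OF fin this, of E]
            have "card (arcs E C) + 5 \<le> card (arcs E S)" using five by linarith
            then have le: "card (arcs E C) div 5 + 2 \<le> card (arcs E S) div 5 + 1" by linarith
            have "card C < card S"
              using psubset_card_mono[OF fin components_psubset[OF conn w(1) C]] .
            moreover have "card (in_arcs E C (reach E C v)) \<le> 4" if "v \<in> C" for v
            proof -
              have "C \<subseteq> S" "v \<in> S" using CS that by blast+
              then show ?thesis
                using card_in_arcs_reach_mono[OF fin, of C E v] le4[of v] by linarith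
            qed
            ultimately have "elim_le E C (card (arcs E C) div 5 + 2)"
              using component_light_source[OF fin assms(2) conn wS le4 C]
              by (intro less.hyps[OF _ finC connC])
            then show ?thesis using le by (rule elim_le_mono)
          qed
        qed
        then have "elim_le E S (Suc (card (arcs E S) div 5 + 1))"
          by (rule elim_le_delete_source_components[OF fin conn w(1)])
        then show ?thesis by (rule elim_le_mono) simp
      qed
    qed
  qed
qed

section \<open>The general bound\<close>

text \<open>A source losing five arcs pays for its own level; if none exists, one unpaid deletion
  leads to the light case, which raises the constant from 2 to 3.\<close>

lemma elim_le_bound:
  assumes "finite S" "acyclic E"
  shows "elim_le E S (card (arcs E S) div 5 + 3)"
  using assms(1)
proof (induction "card S" arbitrary: S rule: less_induct)
  case less
  \<comment> \<open>The induction hypothesis is passed in as \<open>IH\<close> for proper subsets,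
    so that this also applies to a component equal to the whole set.\<close>
  have conn: "elim_le E S (card (arcs E S) div 5 + 3)"
    if fin: "finite S" and S: "und_connected E S"
      and IH: "\<And>D. D \<subset> S \<Longrightarrow> elim_le E D (card (arcs E D) div 5 + 3)" for S
  proof (cases "\<exists>s\<in>sources E S. 5 \<le> card (in_arcs E S (reach E S s))")
    case True
    then obtain s where s: "s \<in> sources E S" "5 \<le> card (in_arcs E S (reach E S s))" by blast
    let ?D = "S - reach E S s"
    have sS: "s \<in> S" using s by (simp add: sources_def)
    have "?D \<subset> S" using sS reach_self[OF sS, of E] by blast
    then have *: "elim_le E ?D (card (arcs E ?D) div 5 + 3)" by (rule IH)
    have "card (arcs E ?D) + 5 \<le> card (arcs E S)"
      using card_arcs_Diff[OF fin, of ?D "reach E S s" E] s(2) by fastforce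
    then have "Suc (card (arcs E ?D) div 5 + 3) \<le> card (arcs E S) div 5 + 3" by linarith
    with elim_le_delete_source[OF fin S s(1) *] show ?thesis by (rule elim_le_mono)
  next
    case False
    \<comment> \<open>The bound passes from sources to all vertices, since
      \<open>reach E S v\<close> lies inside the reachable set of a source above
      \<open>v\<close>.\<close>
    have le4: "card (in_arcs E S (reach E S v)) \<le> 4" if vS: "v \<in> S" for v
    proof -
      obtain s where s: "s \<in> sources E S" "v \<in> reach E S s"
        using ex_source_above[OF fin assms(2) vS] by blast
      have "in_arcs E S (reach E S v) \<subseteq> in_arcs E S (reach E S s)"
        using reach_trans[OF s(2)] by (auto simp: in_arcs_def)
      then have "card (in_arcs E S (reach E S v)) \<le> card (in_arcs E S (reach E S s))"
        by (intro card_mono finite_in_arcs fin)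
      then show ?thesis using False s(1) by fastforce
    qed
    obtain s where s: "s \<in> sources E S"
      using S ex_source_above[OF fin assms(2)] unfolding und_connected_def by blast
    have sS: "s \<in> S" using s by (simp add: sources_def)
    have "elim_le E C (card (arcs E S) div 5 + 2)"
      if C: "C \<in> components E (S - reach E S s)" for C
    proof -
      have CS: "C \<subseteq> S" using components_psubset[OF S s C] by blast
      have finC: "finite C" using CS fin finite_subset by blast
      have "card (in_arcs E C (reach E C v)) \<le> 4" if "v \<in> C" for v
        using card_in_arcs_reach_mono[OF fin CS, of E v] le4[of v] CS that by fastforce
      then have "elim_le E C (card (arcs E C) div 5 + 2)"
        using component_light_source[OF fin assms(2) S sS le4 C]
        by (intro elim_le_light finC assms(2) component_connected[OF C])
      moreover have "card (arcs E C) \<le> card (arcs E S)" using CS fin by (intro card_mono) auto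
      then have "card (arcs E C) div 5 + 2 \<le> card (arcs E S) div 5 + 2" by (simp add: div_le_mono)
      ultimately show ?thesis by (rule elim_le_mono)
    qed
    then have "elim_le E S (Suc (card (arcs E S) div 5 + 2))"
      by (rule elim_le_delete_source_components[OF fin S s])
    then show ?thesis by (rule elim_le_mono) simp
  qed
  show ?case
  proof (rule elim_le_components[OF less.prems])
    fix C assume C: "C \<in> components E S"
    have CS: "C \<subseteq> S" by (rule components_subset[OF C])
    have finC: "finite C" using CS less.prems finite_subset by blast
    have "elim_le E C (card (arcs E C) div 5 + 3)"
    proof (rule conn[OF finC component_connected[OF C]])
      fix D assume "D \<subset> C"
      then have "card D < card S" "finite D"
        using psubset_card_mono[OF less.prems, of D] CS finC finite_subset by blast+
      then show "elim_le E D (card (arcs E D) div 5 + 3)" using less.hyps by blast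
    qed
    moreover have "card (arcs E C) \<le> card (arcs E S)"
      using CS less.prems by (intro card_mono) auto
    then have "card (arcs E C) div 5 + 3 \<le> card (arcs E S) div 5 + 3" by (simp add: div_le_mono)
    ultimately show "elim_le E C (card (arcs E S) div 5 + 3)" by (rule elim_le_mono)
  qed
qed

theorem mainTheorem10:
  fixes V :: "'a set" and E :: "('a \<times> 'a) set"
  assumes "is_dag V E"
  shows "dtd V E \<le> card E div 5 + 3"
proof -
  have V: "finite V" "acyclic E" and "arcs E V = E" using assms by (auto simp: is_dag_def)
  then obtain d where "d \<le> card E div 5 + 3" "elim_depth E V d"
    using elim_le_bound[OF V] by (auto simp: elim_le_def)
  then show ?thesis unfolding dtd_def using Least_le[of "elim_depth E V" d] by simp
qed

end
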